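(* Let $H$ be an infinite-dimensional separable complex Hilbert space and let $T\in\mathcal{B}(H)$ be a nonzero idempotent operator (i.e. $T^2=T$). Then $T\in\mathcal{M}_r(H)$.
   Context: $\mathcal{B}(H)$ denotes the bounded linear operators on $H$. For a nonzero Hilbert space $M$ and $A\in\mathcal{B}(M)$, the minimum modulus is $m(A)=\inf\{\|Ax\|: x\in M,\ \|x\|=1\}$; $A$ is minimum attaining if there is a unit vector $x_0\in M$ with $\|Ax_0\|=m(A)$. A closed subspace $M\subseteq H$ reduces $T\in\mathcal{B}(H)$ if $T(M)\subseteq M$ and $T^*(M)\subseteq M$. $\mathcal{M}_r(H)$ is the set of all $T\in\mathcal{B}(H)$ such that for every nonzero closed subspace $M$ reducing $T$, the restriction $T|_M:M\to M$ is minimum attaining. *)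

theory Defs
  imports "HOL-Analysis.Analysis"
begin

text \<open>
  Complex inner product spaces, linear in the first argument. The underlying real normed
  structure is the one induced by the complex structure: real scaling is complex scaling by
  real numbers and the norm is the norm of the inner product.
\<close>

class complex_inner = real_normed_vector +
  fixes scaleC :: "complex \<Rightarrow> 'a \<Rightarrow> 'a" (infixr \<open>*\<^sub>C\<close> 75)
    and cinner :: "'a \<Rightarrow> 'a \<Rightarrow> complex"
  assumes scaleC_add_right: "a *\<^sub>C (x + y) = a *\<^sub>C x + a *\<^sub>C y"
    and scaleC_add_left: "(a + b) *\<^sub>C x = a *\<^sub>C x + b *\<^sub>C x"
    and scaleC_scaleC: "a *\<^sub>C (b *\<^sub>C x) = (a * b) *\<^sub>C x"
    and scaleC_one: "1 *\<^sub>C x = x"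
    and scaleR_scaleC: "r *\<^sub>R x = complex_of_real r *\<^sub>C x"
    and cinner_commute: "cinner x y = cnj (cinner y x)"
    and cinner_add_left: "cinner (x + y) z = cinner x z + cinner y z"
    and cinner_scaleC_left: "cinner (a *\<^sub>C x) y = a * cinner x y"
    and cinner_ge_zero: "0 \<le> Re (cinner x x)"
    and cinner_eq_zero_iff: "cinner x x = 0 \<longleftrightarrow> x = 0"
    and norm_eq_sqrt_cinner: "norm x = sqrt (Re (cinner x x))"

class chilbert_space = complex_inner + complete_space

global_interpretation complex_vector:
  vector_space "scaleC :: complex \<Rightarrow> 'a \<Rightarrow> 'a::complex_inner"
  by unfold_locales (rule scaleC_add_right scaleC_add_left scaleC_scaleC scaleC_one)+

definition bounded_clinear :: "('a::complex_inner \<Rightarrow> 'a) \<Rightarrow> bool" where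
  "bounded_clinear T \<longleftrightarrow> bounded_linear T \<and> (\<forall>c x. T (c *\<^sub>C x) = c *\<^sub>C T x)"

text \<open>
  As for the library's \<open>adjoint\<close>, this is meaningful for operators that have an adjoint, which
  on a Hilbert space is every bounded operator; the adjoint is then unique.
\<close>

definition cadjoint :: "('a::chilbert_space \<Rightarrow> 'a) \<Rightarrow> 'a \<Rightarrow> 'a" where
  "cadjoint T = (SOME S. \<forall>x y. cinner (T x) y = cinner x (S y))"

definition reduces :: "'a::chilbert_space set \<Rightarrow> ('a \<Rightarrow> 'a) \<Rightarrow> bool" where
  "reduces M T \<longleftrightarrow> T ` M \<subseteq> M \<and> cadjoint T ` M \<subseteq> M"

text \<open>
  The restriction of \<open>A\<close> to a subspace \<open>M\<close> is represented by the pair of \<open>M\<close> and \<open>A\<close>. The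
  infimum is over a nonempty set exactly when \<open>M\<close> is nonzero.
\<close>

definition min_modulus_on :: "'a::complex_inner set \<Rightarrow> ('a \<Rightarrow> 'a) \<Rightarrow> real" where
  "min_modulus_on M A = Inf {norm (A x) | x. x \<in> M \<and> norm x = 1}"

definition min_attaining_on :: "'a::complex_inner set \<Rightarrow> ('a \<Rightarrow> 'a) \<Rightarrow> bool" where
  "min_attaining_on M A \<longleftrightarrow> (\<exists>x\<^sub>0\<in>M. norm x\<^sub>0 = 1 \<and> norm (A x\<^sub>0) = min_modulus_on M A)"

definition reducing_min_attaining :: "('a::chilbert_space \<Rightarrow> 'a) set" where
  "reducing_min_attaining =
    {T. bounded_clinear T \<and>
        (\<forall>M. complex_vector.subspace M \<and> closed M \<and> M \<noteq> {0} \<and> reduces M T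
          \<longrightarrow> min_attaining_on M T)}"

end

theory Submission imports Defs
begin

text \<open>Let M be a nonzero subspace with T M contained in M. If T kills some nonzero vector of
  M, normalizing it gives a unit vector with value 0, the least a norm can be. Otherwise idempotence
  gives T (T x - x) = 0, and T x - x lies in M, so T x = x: T is the identity on M and every unit
  vector attains the value 1. \<open>idempotent_min_attaining_on\<close> carries out this dichotomy;
  a reducing subspace is in particular invariant under T.\<close>

lemma subspace_normalize:
  fixes M :: "'a::complex_inner set"
  assumes "complex_vector.subspace M" and "x \<in> M" and "x \<noteq> 0"
  shows "x /\<^sub>R norm x \<in> M" and "norm (x /\<^sub>R norm x) = 1"
proof -
  show "x /\<^sub>R norm x \<in> M"
    unfolding scaleR_scaleC using assms by (intro complex_vector.subspace_scale)
  show "norm (x /\<^sub>R norm x) = 1"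
    using assms by simp
qed

text \<open>A least element of a set of reals is its infimum, so a minimizing unit vector settles
  nonemptiness and boundedness below of the set at once.\<close>

lemma min_attaining_onI:
  assumes "x \<in> M" and "norm x = 1"
    and "\<And>y. y \<in> M \<Longrightarrow> norm y = 1 \<Longrightarrow> norm (A x) \<le> norm (A y)"
  shows "min_attaining_on M A"
proof -
  have "min_modulus_on M A = norm (A x)"
    unfolding min_modulus_on_def using assms by (intro cInf_eq_minimum) auto
  then show ?thesis
    unfolding min_attaining_on_def using assms by auto
qed

lemma idempotent_min_attaining_on:
  fixes T :: "'a::complex_inner \<Rightarrow> 'a"
  assumes T: "bounded_clinear T" and idem: "T \<circ> T = T"
    and M: "complex_vector.subspace M" and nz: "M \<noteq> {0}" and inv: "T ` M \<subseteq> M"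
  shows "min_attaining_on M T"
proof -
  interpret T: bounded_linear T
    using T by (simp add: bounded_clinear_def)
  show ?thesis
  proof (cases "\<exists>x\<in>M. x \<noteq> 0 \<and> T x = 0")
    case True
    then obtain x where x: "x \<in> M" "x \<noteq> 0" "T x = 0"
      by blast
    with subspace_normalize[OF M x(1,2)] show ?thesis
      by (intro min_attaining_onI[of "x /\<^sub>R norm x"]) (simp_all add: T.scaleR)
  next
    case False
    \<comment> \<open>With no nonzero kernel vector in M, the defect T x - x, which lies both in the
      kernel and in M, must vanish.\<close>
    have id: "T x = x" if "x \<in> M" for x
    proof -
      have "T (T x) = T x"
        using idem by (metis comp_apply)
      then have "T (T x - x) = 0"
        by (simp add: T.diff)
      moreover have "T x - x \<in> M"
        using that inv by (intro complex_vector.subspace_diff[OF M]) auto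
      ultimately show ?thesis
        using False by auto
    qed
    obtain x where "x \<in> M" "x \<noteq> 0"
      using nz complex_vector.subspace_0[OF M] by blast
    \<comment> \<open>By \<open>id\<close> the norm of T y is 1 for each unit vector y of M, so any
      unit vector is a minimizer.\<close>
    from subspace_normalize[OF M this] show ?thesis
      by (intro min_attaining_onI[of "x /\<^sub>R norm x"]) (simp_all only: id)
  qed
qed

theorem proposition3p13:
  fixes T :: "'a::chilbert_space \<Rightarrow> 'a"
  assumes infinite_dim: "\<not> (\<exists>B :: 'a set. finite B \<and> complex_vector.span B = UNIV)"
    and separable: "\<exists>D :: 'a set. countable D \<and> closure D = UNIV"
    and bounded: "bounded_clinear T"
    and nonzero: "T \<noteq> (\<lambda>x. 0)"
    and idempotent: "T \<circ> T = T"
  shows "T \<in> reducing_min_attaining"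
  using idempotent_min_attaining_on[OF bounded idempotent] bounded
  by (auto simp: reducing_min_attaining_def reduces_def)

end
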